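(* Let $k\in\mathbb N_+$, let $\mathbb V^k$ be either $\mathbb P^k$ or $\mathbb Q^k$, and let $a_1,a_2,\Delta x,\Delta y>0$. Then there exists a symmetric CAD for $\mathbb V^k$ on $\Omega=[-1,1]^2$, with boundary weights $\overline\omega_1,\overline\omega_2$, which is an OCAD on $\Omega$ (i.e. it maximizes $\mathcal G_2$ among all feasible CADs for $\mathbb V^k$ on $\Omega$, symmetric or not) and which satisfies $$\frac{\overline\omega_1\Delta x}{a_1}=\frac{\overline\omega_2\Delta y}{a_2}.$$
   Context: $\mathbb P^k$: real polynomials in $(x,y)$ of total degree at most $k$; $\mathbb Q^k$: real polynomials of degree at most $k$ in each variable. $\Omega=[-1,1]^2$, and $\langle p\rangle_\Omega=\frac14\iint_\Omega p$, $\langle p\rangle_\Omega^{\pm x}=\frac12\int_{-1}^1p(\pm1,y)\,dy$, $\langle p\rangle_\Omega^{\pm y}=\frac12\int_{-1}^1p(x,\pm1)\,dx$, $\langle p\rangle_\Omega^x=\frac12(\langle p\rangle_\Omega^{-x}+\langle p\rangle_\Omega^{+x})$, $\langle p\rangle_\Omega^y=\frac12(\langle p\rangle_\Omega^{-y}+\langle p\rangle_\Omega^{+y})$, $\overline{p(a,b)}=\frac14[p(a,b)+p(-a,b)+p(a,-b)+p(-a,-b)]$. A feasible CAD for $\mathbb V^k$ on $\Omega$ is an identity $$\langle p\rangle_\Omega=\omega_1^-\langle p\rangle_\Omega^{-x}+\omega_1^+\langle p\rangle_\Omega^{+x}+\omega_2^-\langle p\rangle_\Omega^{-y}+\omega_2^+\langle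 p\rangle_\Omega^{+y}+\sum_{s=1}^S\omega_s\,p(x^{(s)},y^{(s)})$$ ($S\ge 0$ finite) valid for all $p\in\mathbb V^k$, with all weights positive and all nodes in $\Omega$. Its objective value is $$\mathcal G_2(\omega_1^-,\omega_1^+,\omega_2^-,\omega_2^+)=\min\Big\{\frac{\omega_1^-\Delta x}{a_1},\frac{\omega_1^+\Delta x}{a_1},\frac{\omega_2^-\Delta y}{a_2},\frac{\omega_2^+\Delta y}{a_2}\Big\},$$ where $\Delta x,\Delta y$ are the given parameters (not the side lengths of $\Omega$). A symmetric CAD is a feasible CAD that can be written as $$\langle p\rangle_\Omega=2\overline\omega_1\langle p\rangle_\Omega^x+2\overline\omega_2\langle p\rangle_\Omega^y+\sum_{s=1}^S\omega_s\,\overline{p(x^{(s)},y^{(s)})}\quad\forall p\in\mathbb V^k$$ with $\overline\omega_1,\overline\omega_2,\omega_s>0$ and $(x^{(s)},y^{(s)})\in[0,1]^2$; as a feasible CAD its boundary weights are $\omega_1^\pm=\overline\omega_1$, $\omega_2^\pm=\overline\omega_2$. *)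

theory Defs
  imports "HOL-Analysis.Analysis"
begin

text \<open>Bivariate real polynomials are represented by their polynomial functions on the plane.\<close>

definition poly_P :: "nat \<Rightarrow> (real \<times> real \<Rightarrow> real) set" where
  "poly_P k = {p. \<exists>c. p = (\<lambda>(x, y). \<Sum>i\<le>k. \<Sum>j\<le>k - i. c i j * x ^ i * y ^ j)}"

definition poly_Q :: "nat \<Rightarrow> (real \<times> real \<Rightarrow> real) set" where
  "poly_Q k = {p. \<exists>c. p = (\<lambda>(x, y). \<Sum>i\<le>k. \<Sum>j\<le>k. c i j * x ^ i * y ^ j)}"

definition Omega :: "(real \<times> real) set" where
  "Omega = {-1..1} \<times> {-1..1}"

definition cell_avg :: "(real \<times> real \<Rightarrow> real) \<Rightarrow> real" where
  "cell_avg p = 1/4 * integral Omega p"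

text \<open>Averages over the edges \<open>x = s\<close> and \<open>y = s\<close>; only \<open>s = -1\<close> and \<open>s = 1\<close> are used.\<close>

definition edge_avg_x :: "real \<Rightarrow> (real \<times> real \<Rightarrow> real) \<Rightarrow> real" where
  "edge_avg_x s p = 1/2 * integral {-1..1} (\<lambda>y. p (s, y))"

definition edge_avg_y :: "real \<Rightarrow> (real \<times> real \<Rightarrow> real) \<Rightarrow> real" where
  "edge_avg_y s p = 1/2 * integral {-1..1} (\<lambda>x. p (x, s))"

definition pair_avg_x :: "(real \<times> real \<Rightarrow> real) \<Rightarrow> real" where
  "pair_avg_x p = 1/2 * (edge_avg_x (-1) p + edge_avg_x 1 p)"

definition pair_avg_y :: "(real \<times> real \<Rightarrow> real) \<Rightarrow> real" where
  "pair_avg_y p = 1/2 * (edge_avg_y (-1) p + edge_avg_y 1 p)"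

definition reflect_avg :: "(real \<times> real \<Rightarrow> real) \<Rightarrow> real \<times> real \<Rightarrow> real" where
  "reflect_avg p = (\<lambda>(a, b). 1/4 * (p (a, b) + p (-a, b) + p (a, -b) + p (-a, -b)))"

text \<open>
  The data of a cell average decomposition: the boundary weights on the edges
  \<open>x = -1\<close>, \<open>x = 1\<close>, \<open>y = -1\<close>, \<open>y = 1\<close>,
  and a finite (possibly empty) list of pairs (weight, node).
\<close>

record cad =
  wx_minus :: real
  wx_plus :: real
  wy_minus :: real
  wy_plus :: real
  nodes :: "(real \<times> (real \<times> real)) list"

definition feasible_cad :: "(real \<times> real \<Rightarrow> real) set \<Rightarrow> cad \<Rightarrow> bool" where
  "feasible_cad V C \<longleftrightarrow>
     wx_minus C > 0 \<and> wx_plus C > 0 \<and> wy_minus C > 0 \<and> wy_plus C > 0 \<and>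
     (\<forall>(w, z) \<in> set (nodes C). w > 0 \<and> z \<in> Omega) \<and>
     (\<forall>p\<in>V. cell_avg p =
        wx_minus C * edge_avg_x (-1) p + wx_plus C * edge_avg_x 1 p +
        wy_minus C * edge_avg_y (-1) p + wy_plus C * edge_avg_y 1 p +
        (\<Sum>(w, z)\<leftarrow>nodes C. w * p z))"

definition cad_objective :: "real \<Rightarrow> real \<Rightarrow> real \<Rightarrow> real \<Rightarrow> cad \<Rightarrow> real" where
  "cad_objective a1 a2 dx dy C =
     Min {wx_minus C * dx / a1, wx_plus C * dx / a1,
          wy_minus C * dy / a2, wy_plus C * dy / a2}"

definition optimal_cad ::
  "(real \<times> real \<Rightarrow> real) set \<Rightarrow> real \<Rightarrow> real \<Rightarrow> real \<Rightarrow> real \<Rightarrow> cad \<Rightarrow> bool" where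
  "optimal_cad V a1 a2 dx dy C \<longleftrightarrow>
     feasible_cad V C \<and>
     (\<forall>D. feasible_cad V D \<longrightarrow>
        cad_objective a1 a2 dx dy D \<le> cad_objective a1 a2 dx dy C)"

text \<open>
  \<open>C\<close> is a symmetric CAD with boundary weights \<open>w1\<close>, \<open>w2\<close>.
  That the node sum of \<open>C\<close> can be written through reflection averages is required for
  arbitrary functions \<open>f\<close>, not only on \<open>V\<close>: it says that the weighted nodes of \<open>C\<close>
  themselves are symmetric, regardless of their order and of how coinciding nodes are listed.
\<close>

definition symmetric_cad ::
  "(real \<times> real \<Rightarrow> real) set \<Rightarrow> real \<Rightarrow> real \<Rightarrow> cad \<Rightarrow> bool" where
  "symmetric_cad V w1 w2 C \<longleftrightarrow>
     feasible_cad V C \<and> w1 > 0 \<and> w2 > 0 \<and>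
     wx_minus C = w1 \<and> wx_plus C = w1 \<and> wy_minus C = w2 \<and> wy_plus C = w2 \<and>
     (\<exists>ns. (\<forall>(w, z) \<in> set ns. w > 0 \<and> z \<in> {0..1} \<times> {0..1}) \<and>
        (\<forall>f. (\<Sum>(w, z)\<leftarrow>nodes C. w * f z) = (\<Sum>(w, z)\<leftarrow>ns. w * reflect_avg f z)) \<and>
        (\<forall>p\<in>V. cell_avg p =
           2 * w1 * pair_avg_x p + 2 * w2 * pair_avg_y p +
           (\<Sum>(w, z)\<leftarrow>ns. w * reflect_avg p z)))"

end

theory Submission
  imports Defs "HOL-Computational_Algebra.Polynomial"
begin

text \<open>
  Fix the boundary weights \<open>t * a1 / dx\<close> and \<open>t * a2 / dy\<close>, so that all four terms of the objective
  equal \<open>t\<close>. The rest of the cell average is then a functional \<open>L t\<close> on the monomials of \<open>V\<close>, and a CAD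
  with these weights exists iff \<open>L t\<close> lies in the convex cone spanned by point evaluations on the
  square. By Caratheodory's theorem boundedly many nodes suffice, so compactness yields a largest
  such \<open>t\<close>. Boundary weights of an arbitrary feasible CAD that exceed the balanced ones can be moved
  to interior nodes, since edge averages lie in the cone; hence this \<open>t\<close> is optimal. As \<open>L t\<close>
  vanishes on monomials with an odd exponent, averaging the nodes over the reflections does no harm.

  That some \<open>t > 0\<close> is admissible follows by tensoring a one-dimensional quadrature with positive
  weights that uses both endpoints. It arises from the composite trapezoidal rule with \<open>m\<close>
  panels: making it exact by Lagrange interpolation at \<open>k + 1\<close> fixed nodes changes the weights by
  \<open>O(1 / m ^ 2)\<close>, while the weights themselves are at least \<open>1 / (2 * m)\<close>.
\<close>

section \<open>Positive quadrature on an interval\<close>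

lemma poly_antiderivative: "\<exists>P. pderiv P = (p :: real poly)"
proof -
  define F where "F i = monom (coeff p i / real (Suc i)) (Suc i)" for i
  have "pderiv (\<Sum>i\<le>degree p. F i) = (\<Sum>i\<le>degree p. pderiv (F i))"
    using higher_pderiv_sum[of 1 F "{..degree p}"] by simp
  also have "\<dots> = p"
    by (simp add: F_def pderiv_monom poly_as_sum_of_monoms del: of_nat_Suc)
  finally show ?thesis by blast
qed

lemma integral_poly_pderiv:
  fixes a b :: real
  assumes "a \<le> b"
  shows "integral {a..b} (poly (pderiv P)) = poly P b - poly P a"
  by (rule integral_unique, rule fundamental_theorem_of_calculus)
     (use assms in \<open>auto intro!: has_real_derivative_iff_has_vector_derivative[THEN iffD1]
        DERIV_subset[OF poly_DERIV]\<close>)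

section \<open>Error of the composite trapezoidal rule\<close>

text \<open>Taylor expansion at \<open>a\<close> of \<open>P\<close> to order three and of its
  derivative to order two: all terms up to \<open>(b - a) ^ 2\<close> cancel. What remains involves
  only the third derivative, which is bounded on the whole interval, so one \<open>C\<close> serves
  every panel.\<close>

lemma trapezoid_panel_error:
  fixes P :: "real poly"
  shows "\<exists>C\<ge>0. \<forall>a b. -1 \<le> a \<and> a < b \<and> b \<le> 1 \<longrightarrow>
    \<bar>poly P b - poly P a - (b - a) / 2 * (poly (pderiv P) a + poly (pderiv P) b)\<bar> \<le> C * (b - a) ^ 3"
proof -
  define D where "D n = poly ((pderiv ^^ n) P)" for n
  have deriv: "DERIV (D n) x :> D (Suc n) x" for n x
    by (simp add: D_def poly_DERIV)
  have "bounded (D 3 ` {-1..1})"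
    unfolding D_def by (intro compact_imp_bounded compact_continuous_image continuous_intros) auto
  then obtain C where C: "\<And>x. x \<in> {-1..1} \<Longrightarrow> \<bar>D 3 x\<bar> \<le> C"
    by (fastforce simp: bounded_iff)
  have "0 \<le> C" using C[of 0] by simp
  moreover have "\<bar>poly P b - poly P a - (b - a) / 2 * (poly (pderiv P) a + poly (pderiv P) b)\<bar>
      \<le> C * (b - a) ^ 3"
    if ab: "-1 \<le> a" "a < b" "b \<le> 1" for a b
  proof -
    obtain t where t: "a < t" "t < b"
      "D 0 b = (\<Sum>m<3. (D m a / fact m) * (b - a)^m) + (D 3 t / fact 3) * (b - a)^3"
      using Taylor_up[of 3 D "D 0" a b a] deriv ab by auto
    obtain s where s: "a < s" "s < b"
      "D 1 b = (\<Sum>m<2. (D (Suc m) a / fact m) * (b - a)^m) + (D (Suc 2) s / fact 2) * (b - a)^2"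
      using Taylor_up[of 2 "\<lambda>n. D (Suc n)" "D 1" a b a] deriv ab by auto
    have "\<bar>D 3 t\<bar> \<le> C" "\<bar>D 3 s\<bar> \<le> C" using C s t ab by auto
    then have le: "\<bar>D 3 t / 6 - D 3 s / 4\<bar> \<le> C" by linarith
    have "D 0 b - D 0 a - (b - a) / 2 * (D 1 a + D 1 b) = (D 3 t / 6 - D 3 s / 4) * (b - a)^3"
      unfolding t(3) s(3) by (simp add: eval_nat_numeral field_simps)
    then have "\<bar>D 0 b - D 0 a - (b - a) / 2 * (D 1 a + D 1 b)\<bar> \<le> C * (b - a)^3"
      using le ab by (simp add: abs_mult mult_right_mono)
    then show ?thesis by (simp add: D_def)
  qed
  ultimately show ?thesis by blast
qed

definition grid :: "nat \<Rightarrow> nat \<Rightarrow> real" where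
  "grid m j = -1 + 2 * real j / real m"

text \<open>Approximates the mean value over the interval, not the integral: half the panel width
  \<open>2 / m\<close>, times the factor 1/2 of the mean.\<close>

definition trapezoid :: "nat \<Rightarrow> (real \<Rightarrow> real) \<Rightarrow> real" where
  "trapezoid m f = 1 / (2 * real m) * (\<Sum>j<m. f (grid m j) + f (grid m (Suc j)))"

text \<open>Each of the \<open>m\<close> panels has width \<open>2 / m\<close> and contributes an
  error of order \<open>m ^ -3\<close>; summing them loses one power.\<close>

lemma trapezoid_error:
  fixes p :: "real poly"
  shows "\<exists>C\<ge>0. \<forall>m\<ge>1. \<bar>1/2 * integral {-1..1} (poly p) - trapezoid m (poly p)\<bar> \<le> C / real m ^ 2"
proof -
  obtain P where P: "p = pderiv P" using poly_antiderivative by metis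
  obtain C where C: "C \<ge> 0" "\<And>a b. -1 \<le> a \<Longrightarrow> a < b \<Longrightarrow> b \<le> 1 \<Longrightarrow>
    \<bar>poly P b - poly P a - (b - a) / 2 * (poly p a + poly p b)\<bar> \<le> C * (b - a) ^ 3"
    using trapezoid_panel_error[of P] P by blast
  have "\<bar>1/2 * integral {-1..1} (poly p) - trapezoid m (poly p)\<bar> \<le> 4 * C / real m ^ 2"
    if m: "m \<ge> 1" for m
  proof -
    let ?x = "grid m"
    have diff: "?x (Suc j) - ?x j = 2 / real m" for j
      by (simp add: grid_def add_divide_distrib)
    have "1/2 * integral {-1..1} (poly p) - trapezoid m (poly p)
        = 1/2 * (\<Sum>j<m. poly P (?x (Suc j)) - poly P (?x j)
            - (?x (Suc j) - ?x j) / 2 * (poly p (?x j) + poly p (?x (Suc j))))"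
    proof -
      have "(\<Sum>j<m. poly P (?x (Suc j)) - poly P (?x j)) = poly P 1 - poly P (-1)"
        using m by (subst sum_lessThan_telescope) (simp add: grid_def)
      then show ?thesis
        unfolding diff trapezoid_def P
        by (subst integral_poly_pderiv)
           (simp_all add: sum_subtractf sum_distrib_left right_diff_distrib)
    qed
    also have "\<bar>\<dots>\<bar> \<le> 1/2 * (\<Sum>j<m. C * (2 / real m) ^ 3)"
    proof -
      have "\<bar>poly P (?x (Suc j)) - poly P (?x j)
            - (?x (Suc j) - ?x j) / 2 * (poly p (?x j) + poly p (?x (Suc j)))\<bar>
          \<le> C * (2 / real m) ^ 3" if "j < m" for j
      proof -
        have "?x j < ?x (Suc j)" "-1 \<le> ?x j" "?x (Suc j) \<le> 1"
          using that by (auto simp: grid_def field_simps)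
        then show ?thesis using C(2)[of "?x j" "?x (Suc j)"] by (simp only: diff)
      qed
      then have "\<bar>\<Sum>j<m. poly P (?x (Suc j)) - poly P (?x j)
            - (?x (Suc j) - ?x j) / 2 * (poly p (?x j) + poly p (?x (Suc j)))\<bar>
          \<le> (\<Sum>j<m. C * (2 / real m) ^ 3)"
        by (intro order_trans[OF sum_abs] sum_mono) auto
      then show ?thesis by (simp add: abs_mult)
    qed
    also have "\<dots> = 4 * C / real m ^ 2"
      using m by (simp add: field_simps eval_nat_numeral)
    finally show ?thesis .
  qed
  then show ?thesis using C(1) by (intro exI[of _ "4 * C"]) auto
qed

section \<open>Correcting the trapezoidal rule to an exact one\<close>

text \<open>Both sides agree at \<open>k + 1\<close> distinct points and have degree at most
  \<open>k\<close>. The \<open>l i\<close> are chosen before \<open>p\<close>, so a linear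
  functional on these polynomials is known from its values on finitely many fixed ones.\<close>

lemma lagrange_basis:
  fixes y :: "nat \<Rightarrow> 'a :: field"
  assumes inj: "inj_on y {..k}"
  shows "\<exists>l. \<forall>p. degree p \<le> k \<longrightarrow> p = (\<Sum>i\<le>k. smult (poly p (y i)) (l i))"
proof -
  define q where "q i = (\<Prod>j\<in>{..k} - {i}. [:- y j, 1:])" for i
  define l where "l i = smult (1 / poly (q i) (y i)) (q i)" for i
  have deg: "degree (l i) \<le> k" if "i \<le> k" for i
  proof -
    have "degree (q i) \<le> sum (degree \<circ> (\<lambda>j. [:- y j, 1:])) ({..k} - {i})"
      unfolding q_def by (rule degree_prod_sum_le) simp
    also have "\<dots> = k" using that by simp
    finally show ?thesis unfolding l_def using degree_smult_le le_trans by blast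
  qed
  have val: "poly (l i) (y j) = (if j = i then 1 else 0)" if "i \<le> k" "j \<le> k" for i j
    using that inj by (auto simp: l_def q_def poly_prod inj_on_def)
  have "p = (\<Sum>i\<le>k. smult (poly p (y i)) (l i))" if p: "degree p \<le> k" for p
  proof (rule poly_eqI_degree)
    show "poly p x = poly (\<Sum>i\<le>k. smult (poly p (y i)) (l i)) x" if "x \<in> y ` {..k}" for x
      using that by (auto simp: poly_sum val if_distrib[of "(*) _"] cong: if_cong)
    show "degree p < card (y ` {..k})"
      using p inj by (simp add: card_image)
    have "degree (\<Sum>i\<le>k. smult (poly p (y i)) (l i)) \<le> k"
      by (intro degree_sum_le) (auto intro: order_trans[OF degree_smult_le] deg)
    then show "degree (\<Sum>i\<le>k. smult (poly p (y i)) (l i)) < card (y ` {..k})"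
      using inj by (simp add: card_image)
  qed
  then show ?thesis by blast
qed

text \<open>The error functional \<open>E\<close> of the trapezoidal rule is itself a combination of
  values at the \<open>k + 1\<close> coarse nodes \<open>grid k i\<close>. If these belong to the
  fine grid, adding that combination to the rule makes it exact and alters only the weights at those
  nodes.\<close>

lemma positive_quadrature:
  assumes k: "k \<ge> 1"
  shows "\<exists>n W. n \<ge> 1 \<and> (\<forall>j\<le>n. W j > 0) \<and>
    (\<forall>p. degree p \<le> k \<longrightarrow>
       1/2 * integral {-1..1} (poly p) = (\<Sum>j\<le>n. W j * poly p (grid n j)))"
proof -
  have "inj_on (grid k) {..k}"
    using k by (auto simp: inj_on_def grid_def)
  then obtain l where l: "\<And>p. degree p \<le> k \<Longrightarrow> p = (\<Sum>i\<le>k. smult (poly p (grid k i)) (l i))"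
    using lagrange_basis by metis
  obtain C where C: "\<And>i. C i \<ge> 0" "\<And>i m. m \<ge> 1 \<Longrightarrow>
      \<bar>1/2 * integral {-1..1} (poly (l i)) - trapezoid m (poly (l i))\<bar> \<le> C i / real m ^ 2"
  proof -
    have "\<exists>C. \<forall>i. C i \<ge> 0 \<and> (\<forall>m\<ge>1.
        \<bar>1/2 * integral {-1..1} (poly (l i)) - trapezoid m (poly (l i))\<bar> \<le> C i / real m ^ 2)"
      by (rule choice) (use trapezoid_error in blast)
    with that show ?thesis by blast
  qed
  \<comment> \<open>Large enough that each correction, at most \<open>C i / m ^ 2\<close>, stays
    below the smallest trapezoidal weight \<open>1 / (2 * m)\<close>. As \<open>m\<close> is a
    multiple of \<open>k\<close>, the coarse node \<open>grid k i\<close> is the fine node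
    \<open>grid m (i * r)\<close>.\<close>
  define r where "r = Suc (nat \<lceil>2 * sum C {..k}\<rceil>)"
  define m where "m = k * r"
  have r: "real r > 2 * sum C {..k}" "r \<ge> 1" unfolding r_def by linarith+
  have "r \<le> m" using k by (simp add: m_def)
  then have m: "m \<ge> 1" "real m > 2 * sum C {..k}" using r by linarith+
  define E where "E f = 1/2 * integral {-1..1} f - trapezoid m f" for f
  \<comment> \<open>The first summand counts the panels with left end, respectively right end, at
    node \<open>j\<close>; the second is the correction, present only at coarse nodes.\<close>
  define W where "W j = ((if j < m then 1 else 0) + (if 0 < j then 1 else 0)) / (2 * real m)
      + (if r dvd j then E (poly (l (j div r))) else 0)" for j
  have Wpos: "W j > 0" if j: "j \<le> m" for j
  proof -
    have "\<bar>E (poly (l i))\<bar> < 1 / (2 * real m)" if "i \<le> k" for i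
    proof -
      have "C i \<le> sum C {..k}"
        using that C(1) by (intro member_le_sum) auto
      then have "C i / real m ^ 2 < 1 / (2 * real m)"
        using m by (auto simp: field_simps power2_eq_square)
      moreover have "\<bar>E (poly (l i))\<bar> \<le> C i / real m ^ 2"
        unfolding E_def by (rule C(2)[OF m(1)])
      ultimately show ?thesis by linarith
    qed
    moreover have "j div r \<le> k"
      using j r(2) unfolding m_def by (metis div_le_mono nonzero_mult_div_cancel_right not_one_le_zero)
    ultimately have "\<bar>if r dvd j then E (poly (l (j div r))) else 0\<bar> < 1 / (2 * real m)"
      using m by auto
    moreover have "1 / (2 * real m) \<le>
        ((if j < m then 1 else 0) + (if 0 < j then 1 else 0)) / (2 * real m)"
      using j m by (auto simp: divide_right_mono)
    ultimately show ?thesis unfolding W_def by linarith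
  qed
  have exact: "1/2 * integral {-1..1} (poly p) = (\<Sum>j\<le>m. W j * poly p (grid m j))"
    if p: "degree p \<le> k" for p
  proof -
    have integrable: "(\<lambda>x. c * poly q x) integrable_on {-1..1}" for c :: real and q
      by (intro integrable_continuous_interval continuous_intros)
    have pl: "poly p = (\<lambda>x. \<Sum>i\<le>k. poly p (grid k i) * poly (l i) x)"
      using l[OF p] by (metis (no_types, lifting) ext poly_smult poly_sum sum.cong)
    have "E (poly p) = (\<Sum>i\<le>k. poly p (grid k i) * E (poly (l i)))"
    proof -
      have "integral {-1..1} (poly p) = (\<Sum>i\<le>k. poly p (grid k i) * integral {-1..1} (poly (l i)))"
        by (subst pl, subst integral_sum) (auto simp: integrable)
      moreover have "trapezoid m (poly p) = (\<Sum>i\<le>k. poly p (grid k i) * trapezoid m (poly (l i)))"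
        by (subst pl) (simp add: trapezoid_def sum_distrib_left sum.distrib sum.swap[of _ "{..<m}"]
            algebra_simps)
      ultimately show ?thesis
        by (simp add: E_def sum_distrib_left right_diff_distrib sum_subtractf algebra_simps)
    qed
    also have "\<dots> = (\<Sum>i\<le>k. poly p (grid m (i * r)) * E (poly (l (i * r div r))))"
      using r k by (intro sum.cong) (auto simp: grid_def m_def)
    also have "\<dots> = (\<Sum>j\<in>(\<lambda>i. i * r) ` {..k}. poly p (grid m j) * E (poly (l (j div r))))"
      using r by (subst sum.reindex) (auto simp: inj_on_def)
    also have "\<dots> = (\<Sum>j\<le>m. (if r dvd j then E (poly (l (j div r))) else 0) * poly p (grid m j))"
    proof (intro sum.mono_neutral_cong_left ballI)
      show "(\<lambda>i. i * r) ` {..k} \<subseteq> {..m}" by (auto simp: m_def)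
      show "(if r dvd j then E (poly (l (j div r))) else 0) * poly p (grid m j) = 0"
        if "j \<in> {..m} - (\<lambda>i. i * r) ` {..k}" for j
        using that r by (auto simp: m_def dvd_def image_iff mult.commute)
    qed auto
    finally have E: "E (poly p) =
      (\<Sum>j\<le>m. (if r dvd j then E (poly (l (j div r))) else 0) * poly p (grid m j))" .
    have "trapezoid m (poly p) = (\<Sum>j\<le>m.
        ((if j < m then 1 else 0) + (if 0 < j then 1 else 0)) / (2 * real m) * poly p (grid m j))"
    proof -
      have "(\<Sum>j<m. poly p (grid m j)) = (\<Sum>j\<le>m. (if j < m then 1 else 0) * poly p (grid m j))"
        by (intro sum.mono_neutral_cong_left) auto
      moreover have "(\<Sum>j<m. poly p (grid m (Suc j)))
          = (\<Sum>j\<le>m. (if 0 < j then 1 else 0) * poly p (grid m j))"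
        by (simp add: sum.atMost_shift)
      ultimately show ?thesis
        by (simp add: trapezoid_def sum.distrib sum_distrib_left algebra_simps add_divide_distrib)
    qed
    with E show ?thesis
      unfolding E_def W_def by (simp add: sum.distrib distrib_right)
  qed
  show ?thesis
    using m Wpos exact by blast
qed

section \<open>Cones spanned by point evaluations\<close>

text \<open>Gaussian elimination, by induction on the equations: an equation that is not trivial on
  \<open>F\<close> is solved for one unknown \<open>c y\<close>, and substituting removes one
  equation and one unknown.\<close>

lemma underdetermined_nontrivial_solution:
  fixes g :: "'a \<Rightarrow> 'i \<Rightarrow> 'f :: field"
  assumes "finite I" "finite F" "card I < card F"
  shows "\<exists>c. (\<exists>z\<in>F. c z \<noteq> 0) \<and> (\<forall>i\<in>I. (\<Sum>z\<in>F. c z * g z i) = 0)"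
  using assms
proof (induction I arbitrary: F g rule: finite_induct)
  case empty
  then obtain z where "z \<in> F" by fastforce
  then show ?case by (intro exI[of _ "\<lambda>_. 1"]) auto
next
  case (insert i I)
  show ?case
  proof (cases "\<forall>z\<in>F. g z i = 0")
    case True
    have "card I < card F" using insert by simp
    from insert.IH[OF insert.prems(1) this, of g] obtain c where
      "\<exists>z\<in>F. c z \<noteq> 0" "\<forall>i\<in>I. (\<Sum>z\<in>F. c z * g z i) = 0" by blast
    with True show ?thesis by (intro exI[of _ c]) auto
  next
    case False
    then obtain y where y: "y \<in> F" "g y i \<noteq> 0" by blast
    have "card I < card (F - {y})" using insert y by simp
    from insert.IH[OF _ this, of "\<lambda>z j. g z j - g z i / g y i * g y j"] insert.prems
    obtain c where c: "\<exists>z\<in>F - {y}. c z \<noteq> 0"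
      "\<And>j. j \<in> I \<Longrightarrow> (\<Sum>z\<in>F - {y}. c z * (g z j - g z i / g y i * g y j)) = 0" by auto
    define d where "d = c(y := - (\<Sum>z\<in>F - {y}. c z * g z i) / g y i)"
    have sum_d: "(\<Sum>z\<in>F. d z * g z j) = (\<Sum>z\<in>F - {y}. c z * g z j) + d y * g y j" for j
    proof -
      have "(\<Sum>z\<in>F. d z * g z j) = d y * g y j + (\<Sum>z\<in>F - {y}. d z * g z j)"
        using y insert.prems by (simp add: sum.remove)
      also have "(\<Sum>z\<in>F - {y}. d z * g z j) = (\<Sum>z\<in>F - {y}. c z * g z j)"
        by (intro sum.cong) (auto simp: d_def)
      finally show ?thesis by simp
    qed
    have "(\<Sum>z\<in>F. d z * g z i) = 0"
      unfolding sum_d using y by (simp add: d_def)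
    moreover have "(\<Sum>z\<in>F. d z * g z j) = 0" if "j \<in> I" for j
    proof -
      have "(\<Sum>z\<in>F. d z * g z j) = (\<Sum>z\<in>F - {y}. c z * (g z j - g z i / g y i * g y j))"
        unfolding sum_d
        by (simp add: d_def algebra_simps sum_subtractf sum_distrib_left sum_divide_distrib)
      with c(2)[OF that] show ?thesis by simp
    qed
    moreover have "\<exists>z\<in>F. d z \<noteq> 0" using c(1) by (auto simp: d_def)
    ultimately show ?thesis by (intro exI[of _ d]) auto
  qed
qed

lemma caratheodory_cone:
  fixes g :: "'a \<Rightarrow> 'i \<Rightarrow> real"
  assumes "finite I" "finite F" "\<And>z. z \<in> F \<Longrightarrow> w z \<ge> 0"
  shows "\<exists>F' w'. F' \<subseteq> F \<and> card F' \<le> card I \<and> (\<forall>z\<in>F'. w' z \<ge> 0) \<and>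
    (\<forall>i\<in>I. (\<Sum>z\<in>F'. w' z * g z i) = (\<Sum>z\<in>F. w z * g z i))"
  using assms(2,3)
proof (induction "card F" arbitrary: F w rule: less_induct)
  case less
  show ?case
  proof (cases "card F \<le> card I")
    case True
    then show ?thesis using less.prems by blast
  next
    case False
    then obtain c0 where c0: "\<exists>z\<in>F. c0 z \<noteq> 0" "\<forall>i\<in>I. (\<Sum>z\<in>F. c0 z * g z i) = 0"
      using underdetermined_nontrivial_solution[OF assms(1) less.prems(1), of g] by auto
    \<comment> \<open>The sign is chosen so that some coefficient is positive; only those limit the
      multiple that may be subtracted.\<close>
    define c where "c = (if \<exists>z\<in>F. c0 z > 0 then c0 else (\<lambda>z. - c0 z))"
    have c: "\<exists>z\<in>F. c z > 0" "\<And>i. i \<in> I \<Longrightarrow> (\<Sum>z\<in>F. c z * g z i) = 0"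
      using c0 by (auto simp: c_def sum_negf not_less) (metis linorder_neqE_linordered_idom neg_0_less_iff_less not_less)
    define G where "G = {z\<in>F. c z > 0}"
    have G: "finite G" "G \<noteq> {}" using c(1) less.prems by (auto simp: G_def)
    \<comment> \<open>The smallest ratio is the largest admissible multiple, and the weight at its
      minimizer \<open>y\<close> becomes zero.\<close>
    define y where "y = arg_min_on (\<lambda>z. w z / c z) G"
    have y: "y \<in> G" "\<And>z. z \<in> G \<Longrightarrow> w y / c y \<le> w z / c z"
      using arg_min_if_finite(1)[OF G, of "\<lambda>z. w z / c z"] arg_min_least[OF G, of _ "\<lambda>z. w z / c z"]
      by (auto simp: y_def)
    have cy: "c y > 0" "y \<in> F" "w y \<ge> 0" using y(1) less.prems by (auto simp: G_def)
    define v where "v z = w z - w y / c y * c z" for z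
    have v: "v z \<ge> 0" if "z \<in> F" for z
    proof (cases "c z > 0")
      case True
      then have "w y / c y \<le> w z / c z" using y that by (simp add: G_def)
      then show ?thesis using True by (simp add: v_def pos_le_divide_eq)
    next
      case False
      then have "w y / c y * c z \<le> 0" using cy by (intro mult_nonneg_nonpos) auto
      then show ?thesis using less.prems(2)[OF that] by (simp add: v_def)
    qed
    have "v y = 0" using cy by (simp add: v_def)
    have sum_v: "(\<Sum>z\<in>F - {y}. v z * g z i) = (\<Sum>z\<in>F. w z * g z i)" if "i \<in> I" for i
    proof -
      have "(\<Sum>z\<in>F - {y}. v z * g z i) = (\<Sum>z\<in>F. v z * g z i)"
        using cy less.prems \<open>v y = 0\<close> by (simp add: sum.remove[of F y])
      also have "\<dots> = (\<Sum>z\<in>F. w z * g z i) - w y / c y * (\<Sum>z\<in>F. c z * g z i)"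
        by (simp add: v_def algebra_simps sum_subtractf sum_distrib_left sum_divide_distrib)
      finally show ?thesis using c(2)[OF that] by simp
    qed
    have "card (F - {y}) < card F" using cy less.prems by (meson card_Diff1_less)
    from less.hyps[OF this, of v] less.prems v obtain F' w' where
      "F' \<subseteq> F - {y}" "card F' \<le> card I" "\<forall>z\<in>F'. w' z \<ge> 0"
      "\<forall>i\<in>I. (\<Sum>z\<in>F'. w' z * g z i) = (\<Sum>z\<in>F - {y}. v z * g z i)" by auto
    then show ?thesis using sum_v by (intro exI[of _ F'] exI[of _ w']) auto
  qed
qed

section \<open>The cone of nonnegative node sums\<close>

definition in_cone :: "'z set \<Rightarrow> ('i \<Rightarrow> 'z \<Rightarrow> real) \<Rightarrow> 'i set \<Rightarrow> ('i \<Rightarrow> real) \<Rightarrow> bool" where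
  "in_cone Z f I L \<longleftrightarrow> (\<exists>ns. (\<forall>(w, z) \<in> set ns. w \<ge> 0 \<and> z \<in> Z) \<and>
     (\<forall>q\<in>I. L q = (\<Sum>(w, z)\<leftarrow>ns. w * f q z)))"

lemma in_cone_cong: "in_cone Z f I L \<Longrightarrow> (\<And>q. q \<in> I \<Longrightarrow> L q = M q) \<Longrightarrow> in_cone Z f I M"
  by (auto simp: in_cone_def)

lemma in_cone_zero: "in_cone Z f I (\<lambda>q. 0)"
  unfolding in_cone_def by (rule exI[of _ "[]"]) auto

lemma in_cone_eval: "z \<in> Z \<Longrightarrow> in_cone Z f I (\<lambda>q. f q z)"
  unfolding in_cone_def by (rule exI[of _ "[(1, z)]"]) auto

lemma in_cone_add:
  assumes "in_cone Z f I L" "in_cone Z f I M"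
  shows "in_cone Z f I (\<lambda>q. L q + M q)"
proof -
  from assms obtain ns ms where
    "\<forall>(w, z) \<in> set ns. w \<ge> 0 \<and> z \<in> Z" "\<forall>q\<in>I. L q = (\<Sum>(w, z)\<leftarrow>ns. w * f q z)"
    "\<forall>(w, z) \<in> set ms. w \<ge> 0 \<and> z \<in> Z" "\<forall>q\<in>I. M q = (\<Sum>(w, z)\<leftarrow>ms. w * f q z)"
    unfolding in_cone_def by blast
  then show ?thesis unfolding in_cone_def by (intro exI[of _ "ns @ ms"]) auto
qed

lemma in_cone_scale:
  assumes "in_cone Z f I L" "c \<ge> 0"
  shows "in_cone Z f I (\<lambda>q. c * L q)"
proof -
  from assms obtain ns where ns:
    "\<forall>(w, z) \<in> set ns. w \<ge> 0 \<and> z \<in> Z" "\<forall>q\<in>I. L q = (\<Sum>(w, z)\<leftarrow>ns. w * f q z)"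
    unfolding in_cone_def by blast
  have "c * (\<Sum>(w, z)\<leftarrow>ns. w * h z) = (\<Sum>(w, z)\<leftarrow>map (\<lambda>(w, z). (c * w, z)) ns. w * h z)" for h
    by (induction ns) (auto simp: algebra_simps)
  then show ?thesis
    unfolding in_cone_def using ns assms(2)
    by (intro exI[of _ "map (\<lambda>(w, z). (c * w, z)) ns"]) auto
qed

lemma in_cone_sum:
  assumes "\<And>a. a \<in> A \<Longrightarrow> in_cone Z f I (L a)"
  shows "in_cone Z f I (\<lambda>q. \<Sum>a\<in>A. L a q)"
  using assms by (induction A rule: infinite_finite_induct) (auto simp: in_cone_zero in_cone_add)

text \<open>Caratheodory's theorem bounds the number of nodes, and padding makes it exactly
  \<open>card I\<close>. Node lists of varying length thus become points of a single product space,
  where compactness applies.\<close>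

lemma in_cone_bounded_length:
  assumes "finite I" "Z \<noteq> {}"
  shows "in_cone Z f I L \<longleftrightarrow> (\<exists>g :: nat \<Rightarrow> real \<times> 'z. (\<forall>j. fst (g j) \<ge> 0 \<and> snd (g j) \<in> Z) \<and>
     (\<forall>q\<in>I. L q = (\<Sum>j<card I. fst (g j) * f q (snd (g j)))))"
proof
  assume "in_cone Z f I L"
  then obtain ns where ns:
    "\<forall>(w, z) \<in> set ns. w \<ge> 0 \<and> z \<in> Z" "\<forall>q\<in>I. L q = (\<Sum>(w, z)\<leftarrow>ns. w * f q z)"
    unfolding in_cone_def by blast
  have ns1: "fst (ns ! j) \<ge> 0" "snd (ns ! j) \<in> Z" if "j < length ns" for j
    using ns(1) nth_mem[OF that] by auto
  have Lq: "L q = (\<Sum>j<length ns. fst (ns ! j) * f q (snd (ns ! j)))" if "q \<in> I" for q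
    using ns(2) that by (simp add: sum_list_sum_nth atLeast0LessThan split_beta)
  obtain F w where F: "F \<subseteq> {..<length ns}" "card F \<le> card I" "\<forall>j\<in>F. w j \<ge> 0"
    "\<forall>q\<in>I. (\<Sum>j\<in>F. w j * f q (snd (ns ! j))) = L q"
    using caratheodory_cone[OF assms(1), of "{..<length ns}" "\<lambda>j. fst (ns ! j)"
        "\<lambda>j q. f q (snd (ns ! j))"] ns1 Lq by auto
  obtain h where h: "bij_betw h {..<card F} F"
    using F(1) ex_bij_betw_nat_finite[of F] finite_subset by (auto simp: atLeast0LessThan)
  obtain z0 where "z0 \<in> Z" using assms by blast
  \<comment> \<open>Padding by zero weights at an arbitrary point of \<open>Z\<close>.\<close>
  define g where "g j = (if j < card F then (w (h j), snd (ns ! h j)) else (0, z0))" for j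
  have hF: "h j \<in> F" if "j < card F" for j using h that by (auto simp: bij_betw_def)
  have "fst (g j) \<ge> 0 \<and> snd (g j) \<in> Z" for j
    using F(1,3) hF[of j] ns1 \<open>z0 \<in> Z\<close> by (auto simp: g_def subset_iff)
  moreover have "L q = (\<Sum>j<card I. fst (g j) * f q (snd (g j)))" if "q \<in> I" for q
  proof -
    have "L q = (\<Sum>j<card F. w (h j) * f q (snd (ns ! h j)))"
      using F(4) that sum.reindex_bij_betw[OF h, of "\<lambda>j. w j * f q (snd (ns ! j))"] by simp
    also have "\<dots> = (\<Sum>j<card I. fst (g j) * f q (snd (g j)))"
      using F(2) by (intro sum.mono_neutral_cong_left) (auto simp: g_def)
    finally show ?thesis .
  qed
  ultimately show "\<exists>g. (\<forall>j. fst (g j) \<ge> 0 \<and> snd (g j) \<in> Z) \<and>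
     (\<forall>q\<in>I. L q = (\<Sum>j<card I. fst (g j) * f q (snd (g j))))" by blast
next
  assume "\<exists>g. (\<forall>j. fst (g j) \<ge> 0 \<and> snd (g j) \<in> Z) \<and>
     (\<forall>q\<in>I. L q = (\<Sum>j<card I. fst (g j) * f q (snd (g j))))"
  then obtain g where g: "\<And>j. fst (g j) \<ge> 0" "\<And>j. snd (g j) \<in> Z"
     "\<forall>q\<in>I. L q = (\<Sum>j<card I. fst (g j) * f q (snd (g j)))" by blast
  show "in_cone Z f I L"
    unfolding in_cone_def using g
    by (intro exI[of _ "map g [0..<card I]"])
       (auto simp: sum_list_sum_nth atLeast0LessThan split_beta prod_eq_iff)
qed

section \<open>Compactness and the largest parameter on a ray\<close>

lemma compact_Pi_UNIV:
  fixes K :: "'b :: topological_space set"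
  assumes "compact K"
  shows "compact {g :: 'a \<Rightarrow> 'b. \<forall>j. g j \<in> K}"
proof -
  have "compactin (product_topology (\<lambda>_. euclidean) UNIV) (PiE UNIV (\<lambda>_::'a. K))"
    using assms by (simp add: compactin_PiE)
  moreover have "PiE UNIV (\<lambda>_::'a. K) = {g. \<forall>j. g j \<in> K}" by auto
  ultimately show ?thesis by (simp add: euclidean_product_topology)
qed

text \<open>The normalisation \<open>f e = 1\<close> bounds the weights and \<open>B e > 0\<close> bounds the parameter \<open>t\<close>.\<close>

lemma cone_ray_maximum:
  fixes f :: "'i \<Rightarrow> 'z :: t2_space \<Rightarrow> real"
  assumes I: "finite I" "e \<in> I" and Z: "compact Z" "Z \<noteq> {}"
    and cont: "\<And>q. q \<in> I \<Longrightarrow> continuous_on Z (f q)"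
    and fe: "\<And>z. z \<in> Z \<Longrightarrow> f e z = 1"
    and Be: "B e > 0"
    and t0: "t0 \<ge> 0" "in_cone Z f I (\<lambda>q. L q - t0 * B q)"
  shows "\<exists>t\<ge>0. in_cone Z f I (\<lambda>q. L q - t * B q) \<and>
    (\<forall>s\<ge>0. in_cone Z f I (\<lambda>q. L q - s * B q) \<longrightarrow> s \<le> t)"
proof -
  define N where "N = card I"
  \<comment> \<open>At the index \<open>e\<close> the representation says that the weights sum to
    \<open>L e - s * B e\<close>. Hence \<open>s\<close> is at most \<open>L e / B e\<close> and no
    weight exceeds \<open>L e\<close>.\<close>
  define K where "K = {0..L e / B e} \<times> {g :: nat \<Rightarrow> real \<times> 'z. \<forall>j. g j \<in> {0..L e} \<times> Z}"
  define R where "R q x = L q - fst x * B q - (\<Sum>j<N. fst (snd x j) * f q (snd (snd x j)))"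
    for q and x :: "real \<times> (nat \<Rightarrow> real \<times> 'z)"
  define X where "X = {x \<in> K. \<forall>q\<in>I. R q x = 0}"
  have "compact K"
    unfolding K_def by (intro compact_Times compact_Pi_UNIV Z(1)) auto
  have coord: "continuous_on K (\<lambda>x. snd x j)" for j
    by (rule continuous_on_compose2[OF continuous_on_product_coordinates continuous_on_snd])
       (auto intro: continuous_on_id)
  have contR: "continuous_on K (R q)" if "q \<in> I" for q
    unfolding R_def
  proof (intro continuous_intros coord)
    fix j
    show "continuous_on K (\<lambda>x. f q (snd (snd x j)))"
      by (rule continuous_on_compose2[OF cont[OF that] continuous_on_snd[OF coord]])
         (auto simp: K_def mem_Times_iff)
  qed
  have "compact X"
  proof (rule closedin_compact[OF \<open>compact K\<close>])
    have "X = (\<Inter>q\<in>I. {x \<in> K. R q x = 0})" using I by (auto simp: X_def)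
    then show "closedin (top_of_set K) X"
      using I contR by (auto intro!: closedin_INT continuous_closedin_preimage_constant)
  qed
  \<comment> \<open>The admissible parameters are the projection of the compact set
    \<open>X\<close>, so a largest one exists.\<close>
  have cone_iff: "s \<ge> 0 \<and> in_cone Z f I (\<lambda>q. L q - s * B q) \<longleftrightarrow> s \<in> fst ` X" for s
  proof
    assume s: "s \<ge> 0 \<and> in_cone Z f I (\<lambda>q. L q - s * B q)"
    from iffD1[OF in_cone_bounded_length[OF I(1) Z(2)] conjunct2[OF s]]
    obtain g :: "nat \<Rightarrow> real \<times> 'z" where g: "\<And>j. fst (g j) \<ge> 0" "\<And>j. snd (g j) \<in> Z"
      "\<And>q. q \<in> I \<Longrightarrow> L q - s * B q = (\<Sum>j<N. fst (g j) * f q (snd (g j)))"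
      unfolding N_def by blast
    have sum: "L e - s * B e = (\<Sum>j<N. fst (g j))"
      using g(3)[OF I(2)] fe g(2) by simp
    then have "s * B e \<le> L e" using g(1) by (metis diff_ge_0_iff_ge sum_nonneg)
    then have "s \<le> L e / B e" using Be by (simp add: pos_le_divide_eq)
    have le: "fst (g j) \<le> L e" if "j < N" for j
    proof -
      have "fst (g j) \<le> (\<Sum>j<N. fst (g j))"
        using that g(1) by (intro member_le_sum) auto
      also have "\<dots> \<le> L e"
        using sum s Be mult_nonneg_nonneg[of s "B e"] by linarith
      finally show ?thesis .
    qed
    have "0 \<le> L e" using \<open>s * B e \<le> L e\<close> s Be mult_nonneg_nonneg[of s "B e"] by linarith
    \<comment> \<open>Entries from \<open>N\<close> on do not enter the sum, but their weights must
      be reset to meet the bound in \<open>K\<close>.\<close>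
    let ?g = "\<lambda>j. if j < N then g j else (0, snd (g j))"
    have "(s, ?g) \<in> X"
      using s g le \<open>0 \<le> L e\<close> \<open>s \<le> L e / B e\<close> by (auto simp: X_def K_def R_def mem_Times_iff)
    then show "s \<in> fst ` X" by force
  next
    assume "s \<in> fst ` X"
    then obtain g where "(s, g) \<in> X" by force
    then have "s \<ge> 0" and "(\<forall>j. fst (g j) \<ge> 0 \<and> snd (g j) \<in> Z) \<and>
      (\<forall>q\<in>I. L q - s * B q = (\<Sum>j<card I. fst (g j) * f q (snd (g j))))"
      by (auto simp: X_def K_def R_def mem_Times_iff N_def)
    then show "s \<ge> 0 \<and> in_cone Z f I (\<lambda>q. L q - s * B q)"
      by (auto intro!: iffD2[OF in_cone_bounded_length[OF I(1) Z(2)]] exI[of _ g])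
  qed
  have "X \<noteq> {}" using cone_iff[of t0] t0 by auto
  moreover have "continuous_on X fst" by (rule continuous_on_fst[OF continuous_on_id])
  ultimately obtain x where "x \<in> X" "\<forall>y\<in>X. fst y \<le> fst x"
    using continuous_attains_sup[OF \<open>compact X\<close>, of fst] by blast
  then have "fst x \<in> fst ` X" "\<And>s. s \<in> fst ` X \<Longrightarrow> s \<le> fst x" by auto
  then show ?thesis unfolding cone_iff[symmetric] by blast
qed

section \<open>Moments of cell average decompositions\<close>

definition monomial :: "nat \<times> nat \<Rightarrow> real \<times> real \<Rightarrow> real" where
  "monomial q z = fst z ^ fst q * snd z ^ snd q"

definition polys :: "(nat \<times> nat) set \<Rightarrow> (real \<times> real \<Rightarrow> real) set" where
  "polys I = {p. \<exists>c. p = (\<lambda>z. \<Sum>q\<in>I. c q * monomial q z)}"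

lemma polys_Sigma:
  assumes "finite A" "\<And>i. i \<in> A \<Longrightarrow> finite (B i)"
  shows "polys (Sigma A B) =
    {p :: real \<times> real \<Rightarrow> real. \<exists>c. p = (\<lambda>(x, y). \<Sum>i\<in>A. \<Sum>j\<in>B i. c i j * x ^ i * y ^ j)}"
proof -
  have *: "(\<lambda>z. \<Sum>q\<in>Sigma A B. c q * monomial q z) =
      (\<lambda>(x, y). \<Sum>i\<in>A. \<Sum>j\<in>B i. curry c i j * x ^ i * y ^ j)" for c
    using assms by (auto simp: fun_eq_iff monomial_def sum.Sigma mult.assoc intro!: sum.cong)
  show ?thesis
  proof (intro equalityI subsetI)
    fix p assume "p \<in> polys (Sigma A B)"
    then show "p \<in> {p. \<exists>c. p = (\<lambda>(x, y). \<Sum>i\<in>A. \<Sum>j\<in>B i. c i j * x ^ i * y ^ j)}"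
      unfolding polys_def * by blast
  next
    fix p assume "p \<in> {p :: real \<times> real \<Rightarrow> real. \<exists>c. p = (\<lambda>(x, y). \<Sum>i\<in>A. \<Sum>j\<in>B i. c i j * x ^ i * y ^ j)}"
    then obtain c where "p = (\<lambda>(x, y). \<Sum>i\<in>A. \<Sum>j\<in>B i. c i j * x ^ i * y ^ j)" by blast
    then have "p = (\<lambda>z. \<Sum>q\<in>Sigma A B. case_prod c q * monomial q z)"
      unfolding * by simp
    then show "p \<in> polys (Sigma A B)" unfolding polys_def by blast
  qed
qed

lemma poly_P_eq: "poly_P k = polys (Sigma {..k} (\<lambda>i. {..k - i}))"
  by (simp add: poly_P_def polys_Sigma)

lemma poly_Q_eq: "poly_Q k = polys ({..k} \<times> {..k})"
  by (simp add: poly_Q_def polys_Sigma)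

lemma monomial_in_polys:
  assumes "finite I" "q \<in> I"
  shows "monomial q \<in> polys I"
proof -
  have "monomial q = (\<lambda>z. \<Sum>r\<in>I. (if r = q then 1 else 0) * monomial r z)"
  proof
    fix z
    have "(\<Sum>r\<in>I. (if r = q then 1 else 0) * monomial r z) = (\<Sum>r\<in>{q}. monomial r z)"
      using assms by (intro sum.mono_neutral_cong_right) auto
    then show "monomial q z = (\<Sum>r\<in>I. (if r = q then 1 else 0) * monomial r z)"
      by (simp only: sum.insert[OF finite.emptyI] sum.empty empty_iff not_False_eq_True add_0_right)
  qed
  then show ?thesis
    unfolding polys_def mem_Collect_eq by (rule exI[of _ "\<lambda>r. if r = q then 1 else 0"])
qed

lemma continuous_on_monomial: "continuous_on S (monomial q)"
  unfolding monomial_def by (intro continuous_intros)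

definition power_avg :: "nat \<Rightarrow> real" where
  "power_avg i = 1/2 * integral {-1..1} (\<lambda>x. x ^ i)"

lemma power_avg_0 [simp]: "power_avg 0 = 1"
  by (simp add: power_avg_def)

lemma power_avg_odd:
  assumes "odd i"
  shows "power_avg i = 0"
proof -
  have "integral {-1..1::real} (\<lambda>x. (- x) ^ i) = integral {-1..1} (\<lambda>x. x ^ i)"
    using Henstock_Kurzweil_Integration.integral_reflect_real[of "1::real" "-1" "\<lambda>x. x ^ i"] by simp
  then show ?thesis using assms by (simp add: power_avg_def)
qed

lemma cell_avg_eq_iterated:
  assumes "continuous_on Omega p"
  shows "cell_avg p = 1/4 * integral {-1..1} (\<lambda>x. integral {-1..1} (\<lambda>y. p (x, y)))"
proof -
  have "Omega = cbox (-1, -1) (1, 1)" by (simp add: Omega_def cbox_Pair_eq)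
  with assms have "integral Omega p =
      integral (cbox (-1) 1) (\<lambda>x. integral (cbox (-1) 1) (\<lambda>y. p (x, y)))"
    by (metis integral_prod_continuous)
  then show ?thesis by (simp add: cell_avg_def)
qed

lemma cell_avg_monomial: "cell_avg (monomial q) = power_avg (fst q) * power_avg (snd q)"
  by (simp add: cell_avg_eq_iterated continuous_on_monomial) (simp add: monomial_def power_avg_def)

lemma edge_avg_x_monomial: "edge_avg_x s (monomial q) = s ^ fst q * power_avg (snd q)"
  by (simp add: edge_avg_x_def monomial_def power_avg_def)

lemma edge_avg_y_monomial: "edge_avg_y s (monomial q) = s ^ snd q * power_avg (fst q)"
  by (simp add: edge_avg_y_def monomial_def power_avg_def)

lemma cell_avg_sum:
  assumes "finite I"
  shows "cell_avg (\<lambda>z. \<Sum>q\<in>I. c q * monomial q z) = (\<Sum>q\<in>I. c q * cell_avg (monomial q))"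
proof -
  have "Omega = cbox (-1, -1) (1, 1)" by (simp add: Omega_def cbox_Pair_eq)
  then have "(\<lambda>z. c q * monomial q z) integrable_on Omega" for q
    by (metis integrable_continuous continuous_on_mult_left continuous_on_monomial)
  with assms show ?thesis
    by (simp add: cell_avg_def integral_sum sum_distrib_left algebra_simps)
qed

lemma edge_avg_x_sum:
  assumes "finite I"
  shows "edge_avg_x s (\<lambda>z. \<Sum>q\<in>I. c q * monomial q z) = (\<Sum>q\<in>I. c q * edge_avg_x s (monomial q))"
proof -
  have "(\<lambda>y. c q * monomial q (s, y)) integrable_on {-1..1}" for q
    unfolding monomial_def by (intro integrable_continuous_interval continuous_intros)
  with assms show ?thesis
    by (simp add: edge_avg_x_def integral_sum sum_distrib_left algebra_simps)
qed

lemma edge_avg_y_sum: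
  assumes "finite I"
  shows "edge_avg_y s (\<lambda>z. \<Sum>q\<in>I. c q * monomial q z) = (\<Sum>q\<in>I. c q * edge_avg_y s (monomial q))"
proof -
  have "(\<lambda>x. c q * monomial q (x, s)) integrable_on {-1..1}" for q
    unfolding monomial_def by (intro integrable_continuous_interval continuous_intros)
  with assms show ?thesis
    by (simp add: edge_avg_y_def integral_sum sum_distrib_left algebra_simps)
qed

lemma node_sum_linear:
  "(\<Sum>(w, z)\<leftarrow>ns. w * (\<Sum>q\<in>I. c q * f q z)) =
    (\<Sum>q\<in>I. c q * (\<Sum>(w, z)\<leftarrow>ns. w * (f q z :: real)))"
  by (induction ns) (auto simp: sum.distrib sum_distrib_left algebra_simps)

text \<open>Both sides of the CAD identity are linear in \<open>p\<close>, so it suffices to test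
  monomials, whose cell and edge averages factor into one-dimensional ones.\<close>

lemma feasible_cad_polys_iff:
  assumes I: "finite I"
  shows "feasible_cad (polys I) C \<longleftrightarrow>
     wx_minus C > 0 \<and> wx_plus C > 0 \<and> wy_minus C > 0 \<and> wy_plus C > 0 \<and>
     (\<forall>(w, z) \<in> set (nodes C). w > 0 \<and> z \<in> Omega) \<and>
     (\<forall>q\<in>I. power_avg (fst q) * power_avg (snd q) =
        wx_minus C * ((-1) ^ fst q * power_avg (snd q)) + wx_plus C * power_avg (snd q) +
        wy_minus C * ((-1) ^ snd q * power_avg (fst q)) + wy_plus C * power_avg (fst q) +
        (\<Sum>(w, z)\<leftarrow>nodes C. w * monomial q z))"
proof -
  have "(\<forall>p\<in>polys I. cell_avg p =
        wx_minus C * edge_avg_x (-1) p + wx_plus C * edge_avg_x 1 p +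
        wy_minus C * edge_avg_y (-1) p + wy_plus C * edge_avg_y 1 p +
        (\<Sum>(w, z)\<leftarrow>nodes C. w * p z)) \<longleftrightarrow>
     (\<forall>q\<in>I. cell_avg (monomial q) =
        wx_minus C * edge_avg_x (-1) (monomial q) + wx_plus C * edge_avg_x 1 (monomial q) +
        wy_minus C * edge_avg_y (-1) (monomial q) + wy_plus C * edge_avg_y 1 (monomial q) +
        (\<Sum>(w, z)\<leftarrow>nodes C. w * monomial q z))" (is "?L \<longleftrightarrow> ?R")
  proof
    assume ?L
    then show ?R using I monomial_in_polys by blast
  next
    assume R: ?R
    show ?L
    proof
      fix p assume "p \<in> polys I"
      then obtain c where p: "p = (\<lambda>z. \<Sum>q\<in>I. c q * monomial q z)"
        unfolding polys_def by blast
      show "cell_avg p =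
        wx_minus C * edge_avg_x (-1) p + wx_plus C * edge_avg_x 1 p +
        wy_minus C * edge_avg_y (-1) p + wy_plus C * edge_avg_y 1 p +
        (\<Sum>(w, z)\<leftarrow>nodes C. w * p z)"
        unfolding p cell_avg_sum[OF I] edge_avg_x_sum[OF I] edge_avg_y_sum[OF I] node_sum_linear
        using R by (simp add: sum.distrib[symmetric] sum_distrib_left algebra_simps cong: sum.cong)
    qed
  qed
  then show ?thesis
    unfolding feasible_cad_def cell_avg_monomial edge_avg_x_monomial edge_avg_y_monomial by simp
qed

section \<open>Decompositions with balanced boundary weights\<close>

text \<open>The boundary part of a CAD on the monomial \<open>q\<close> when opposite edges share
  the weight \<alpha> or \<beta>; each factor \<open>(-1) ^ i + 1\<close> collects two opposite
  edges.\<close>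

definition boundary :: "real \<Rightarrow> real \<Rightarrow> nat \<times> nat \<Rightarrow> real" where
  "boundary \<alpha> \<beta> q = \<alpha> * (((-1) ^ fst q + 1) * power_avg (snd q)) +
     \<beta> * (((-1) ^ snd q + 1) * power_avg (fst q))"

text \<open>
  The moment left to the interior nodes when the boundary weights are \<open>t * \<alpha>\<close> and \<open>t * \<beta>\<close>.
\<close>

definition interior_moment :: "real \<Rightarrow> real \<Rightarrow> real \<Rightarrow> nat \<times> nat \<Rightarrow> real" where
  "interior_moment \<alpha> \<beta> t q = power_avg (fst q) * power_avg (snd q) - t * boundary \<alpha> \<beta> q"

lemma power_avg_quadrature:
  assumes "k \<ge> 1"
  shows "\<exists>n W. n \<ge> 1 \<and> (\<forall>j\<le>n. W j > 0) \<and> (\<forall>i\<le>k. power_avg i = (\<Sum>j\<le>n. W j * grid n j ^ i))"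
proof -
  obtain n W where W: "n \<ge> 1" "\<forall>j\<le>n. W j > 0"
    "\<And>p. degree p \<le> k \<Longrightarrow> 1/2 * integral {-1..1} (poly p) = (\<Sum>j\<le>n. W j * poly p (grid n j))"
    using positive_quadrature[OF assms] by blast
  have "power_avg i = (\<Sum>j\<le>n. W j * grid n j ^ i)" if "i \<le> k" for i
  proof -
    have "degree (monom (1::real) i) \<le> k" using that by (simp add: degree_monom_eq)
    moreover have "poly (monom (1::real) i) = (\<lambda>x. x ^ i)" by (simp add: fun_eq_iff poly_monom)
    ultimately show ?thesis using W(3)[of "monom 1 i"] by (simp add: power_avg_def)
  qed
  with W show ?thesis by blast
qed

lemma grid_mem: "n \<ge> 1 \<Longrightarrow> j \<le> n \<Longrightarrow> grid n j \<in> {-1..1}"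
  by (auto simp: grid_def field_simps)

text \<open>One-dimensional quadrature along a line parallel to an axis. With \<open>s\<close> at an
  end of the interval this turns edge averages into nodes; with \<open>s\<close> on the grid it
  gives one direction of the tensor rule.\<close>

lemma in_cone_lines:
  assumes k: "k \<ge> 1" and I: "I \<subseteq> {..k} \<times> {..k}" and s: "s \<in> {-1..1}"
  shows "in_cone Omega monomial I (\<lambda>q. s ^ fst q * power_avg (snd q))"
    and "in_cone Omega monomial I (\<lambda>q. s ^ snd q * power_avg (fst q))"
proof -
  obtain n W where W: "n \<ge> 1" "\<forall>j\<le>n. W j > 0"
      "\<forall>i\<le>k. power_avg i = (\<Sum>j\<le>n. W j * grid n j ^ i)"
    using power_avg_quadrature[OF k] by blast
  have "in_cone Omega monomial I (\<lambda>q. \<Sum>j\<le>n. W j * monomial q (s, grid n j))"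
    using s W by (intro in_cone_sum in_cone_scale in_cone_eval)
      (auto simp: Omega_def less_imp_le simp del: atLeastAtMost_iff intro: grid_mem)
  then show "in_cone Omega monomial I (\<lambda>q. s ^ fst q * power_avg (snd q))"
    by (rule in_cone_cong)
       (use W(3) I in \<open>auto simp: monomial_def sum_distrib_left algebra_simps intro!: sum.cong\<close>)
  have "in_cone Omega monomial I (\<lambda>q. \<Sum>j\<le>n. W j * monomial q (grid n j, s))"
    using s W by (intro in_cone_sum in_cone_scale in_cone_eval)
      (auto simp: Omega_def less_imp_le simp del: atLeastAtMost_iff intro: grid_mem)
  then show "in_cone Omega monomial I (\<lambda>q. s ^ snd q * power_avg (fst q))"
    by (rule in_cone_cong)
       (use W(3) I in \<open>auto simp: monomial_def sum_distrib_left algebra_simps intro!: sum.cong\<close>)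
qed

text \<open>The cell average is split into halves: one is discretized in the first variable, the
  other in the second. The end lines of the two rules are the edges, so a small boundary
  contribution can be subtracted from their weights without making them negative.\<close>

lemma interior_moment_in_cone:
  assumes k: "k \<ge> 1" and I: "I \<subseteq> {..k} \<times> {..k}" and pos: "\<alpha> > 0" "\<beta> > 0"
  shows "\<exists>t>0. in_cone Omega monomial I (interior_moment \<alpha> \<beta> t)"
proof -
  obtain n W where W: "n \<ge> 1" "\<forall>j\<le>n. W j > 0"
      "\<forall>i\<le>k. power_avg i = (\<Sum>j\<le>n. W j * grid n j ^ i)"
    using power_avg_quadrature[OF k] by blast
  \<comment> \<open>The smaller end weight; half of it bounds what may be removed, because each rule
    carries only half of \<open>W\<close>.\<close>
  define m where "m = min (W 0) (W n)"
  have m: "m > 0" using W(2) by (simp add: m_def)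
  define t where "t = min (m / (2 * \<alpha>)) (m / (2 * \<beta>))"
  have "t > 0" using m pos by (simp add: t_def)
  have t: "t * \<alpha> \<le> m / 2" "t * \<beta> \<le> m / 2"
    using pos by (simp_all add: t_def min_def field_simps split: if_splits)
  define U where "U \<gamma> j = W j / 2 - (if j = 0 \<or> j = n then t * \<gamma> else 0)" for \<gamma> j
  have U: "U \<gamma> j \<ge> 0" if "j \<le> n" "t * \<gamma> \<le> m / 2" for \<gamma> j
    using that W(2) by (auto simp: U_def m_def less_imp_le)
  have sumU: "(\<Sum>j\<le>n. U \<gamma> j * grid n j ^ i) = power_avg i / 2 - t * \<gamma> * ((-1) ^ i + 1)"
    if "i \<le> k" for \<gamma> i
  proof -
    have "(\<Sum>j\<le>n. (if j = 0 \<or> j = n then t * \<gamma> else 0) * grid n j ^ i)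
        = (\<Sum>j\<in>{0, n}. t * \<gamma> * grid n j ^ i)"
      by (intro sum.mono_neutral_cong_right) auto
    also have "\<dots> = t * \<gamma> * ((-1) ^ i + 1)"
      using W(1) by (simp add: grid_def algebra_simps)
    finally show ?thesis
      using W(3) that
      by (simp add: U_def left_diff_distrib sum_subtractf sum_divide_distrib)
  qed
  have "in_cone Omega monomial I (\<lambda>q.
      (\<Sum>j\<le>n. U \<alpha> j * (grid n j ^ fst q * power_avg (snd q))) +
      (\<Sum>j\<le>n. U \<beta> j * (grid n j ^ snd q * power_avg (fst q))))"
    by (intro in_cone_add in_cone_sum in_cone_scale in_cone_lines[OF k I] grid_mem W(1) U t) auto
  then have "in_cone Omega monomial I (interior_moment \<alpha> \<beta> t)"
  proof (rule in_cone_cong)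
    fix q assume "q \<in> I"
    then have "fst q \<le> k" "snd q \<le> k" using I by auto
    then show "(\<Sum>j\<le>n. U \<alpha> j * (grid n j ^ fst q * power_avg (snd q))) +
      (\<Sum>j\<le>n. U \<beta> j * (grid n j ^ snd q * power_avg (fst q))) = interior_moment \<alpha> \<beta> t q"
      unfolding mult.assoc[symmetric] sum_distrib_right[symmetric] sumU[OF \<open>fst q \<le> k\<close>]
        sumU[OF \<open>snd q \<le> k\<close>]
      by (simp add: interior_moment_def boundary_def algebra_simps)
  qed
  with \<open>t > 0\<close> show ?thesis by blast
qed

text \<open>The exponent \<open>(0, 0)\<close> supplies the normalisation: its monomial is
  constantly 1 and its boundary moment is positive.\<close>

lemma interior_moment_maximum:
  assumes I: "finite I" "(0, 0) \<in> I" "k \<ge> 1" "I \<subseteq> {..k} \<times> {..k}" and pos: "\<alpha> > 0" "\<beta> > 0"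
  shows "\<exists>t>0. in_cone Omega monomial I (interior_moment \<alpha> \<beta> t) \<and>
    (\<forall>s\<ge>0. in_cone Omega monomial I (interior_moment \<alpha> \<beta> s) \<longrightarrow> s \<le> t)"
proof -
  obtain t0 where t0: "t0 > 0" "in_cone Omega monomial I (interior_moment \<alpha> \<beta> t0)"
    using interior_moment_in_cone[OF I(3,4) pos] by blast
  have "compact Omega" "Omega \<noteq> {}"
    unfolding Omega_def by (auto intro: compact_Times)
  moreover have "boundary \<alpha> \<beta> (0, 0) > 0" using pos by (simp add: boundary_def)
  ultimately obtain t where t: "t \<ge> 0" "in_cone Omega monomial I (interior_moment \<alpha> \<beta> t)"
    "\<forall>s\<ge>0. in_cone Omega monomial I (interior_moment \<alpha> \<beta> s) \<longrightarrow> s \<le> t"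
    using cone_ray_maximum[OF I(1,2), of Omega monomial "boundary \<alpha> \<beta>" t0
        "\<lambda>q. power_avg (fst q) * power_avg (snd q)"] t0
    by (auto simp: interior_moment_def[abs_def] continuous_on_monomial monomial_def[of "(0, 0)"])
  moreover have "t > 0" using t(3) t0 less_le_trans[OF t0(1), of t] by simp
  ultimately show ?thesis by blast
qed

text \<open>The excess of each boundary weight of \<open>D\<close> over the balanced one multiplies
  an edge average, which is itself a nonnegative node sum. Moving the excess there leaves exactly
  the balanced boundary weights.\<close>

lemma feasible_imp_in_cone:
  assumes k: "k \<ge> 1" and I: "I \<subseteq> {..k} \<times> {..k}" and D: "feasible_cad (polys I) D"
    and le: "s * \<alpha> \<le> wx_minus D" "s * \<alpha> \<le> wx_plus D" "s * \<beta> \<le> wy_minus D" "s * \<beta> \<le> wy_plus D"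
  shows "in_cone Omega monomial I (interior_moment \<alpha> \<beta> s)"
proof -
  have "finite I" using I finite_subset by blast
  note D = D[unfolded feasible_cad_polys_iff[OF this]]
  have nodes: "in_cone Omega monomial I (\<lambda>q. \<Sum>(w, z)\<leftarrow>nodes D. w * monomial q z)"
    unfolding in_cone_def using D by (intro exI[of _ "nodes D"]) (auto intro: less_imp_le)
  have "in_cone Omega monomial I (\<lambda>q.
     (wx_minus D - s * \<alpha>) * ((-1) ^ fst q * power_avg (snd q)) +
     (wx_plus D - s * \<alpha>) * (1 ^ fst q * power_avg (snd q)) +
     (wy_minus D - s * \<beta>) * ((-1) ^ snd q * power_avg (fst q)) +
     (wy_plus D - s * \<beta>) * (1 ^ snd q * power_avg (fst q)) +
     (\<Sum>(w, z)\<leftarrow>nodes D. w * monomial q z))"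
    using le by (intro in_cone_add in_cone_scale in_cone_lines[OF k I] nodes) auto
  then show ?thesis
    by (rule in_cone_cong)
       (use D in \<open>auto simp: interior_moment_def boundary_def algebra_simps\<close>)
qed

section \<open>Symmetrization by reflections\<close>

definition reflect_nodes :: "(real \<times> (real \<times> real)) list \<Rightarrow> (real \<times> (real \<times> real)) list" where
  "reflect_nodes ns = concat (map (\<lambda>(w, (a, b)).
     [(w / 4, (a, b)), (w / 4, (-a, b)), (w / 4, (a, -b)), (w / 4, (-a, -b))]) ns)"

lemma sum_reflect_nodes:
  "(\<Sum>(w, z)\<leftarrow>reflect_nodes ns. w * f z) = (\<Sum>(w, z)\<leftarrow>ns. w * reflect_avg f z)"
  by (induction ns) (auto simp: reflect_nodes_def reflect_avg_def algebra_simps)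

lemma reflect_avg_monomial:
  "reflect_avg (monomial q) z = (if even (fst q) \<and> even (snd q) then monomial q z else 0)"
  by (cases z) (auto simp: reflect_avg_def monomial_def uminus_power_if)

text \<open>If both exponents are even, the monomial does not see the signs of the coordinates, so
  nodes may be folded into the first quadrant. Otherwise the interior moment and the reflection
  average both vanish.\<close>

lemma interior_moment_symmetric_nodes:
  assumes "in_cone Omega monomial I (interior_moment \<alpha> \<beta> t)"
  shows "\<exists>ns. (\<forall>(w, z) \<in> set ns. w > 0 \<and> z \<in> {0..1} \<times> {0..1}) \<and>
    (\<forall>q\<in>I. interior_moment \<alpha> \<beta> t q = (\<Sum>(w, z)\<leftarrow>ns. w * reflect_avg (monomial q) z))"
proof -
  from assms obtain ms where ms: "\<forall>(w, z) \<in> set ms. w \<ge> 0 \<and> z \<in> Omega"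
    "\<And>q. q \<in> I \<Longrightarrow> interior_moment \<alpha> \<beta> t q = (\<Sum>(w, z)\<leftarrow>ms. w * monomial q z)"
    unfolding in_cone_def by blast
  \<comment> \<open>Zero weights are removed because a CAD requires strictly positive ones.\<close>
  define ns where "ns = map (\<lambda>(w, (a, b)). (w, (\<bar>a\<bar>, \<bar>b\<bar>))) (filter (\<lambda>(w, z). w \<noteq> 0) ms)"
  have "\<forall>(w, z) \<in> set ns. w > 0 \<and> z \<in> {0..1} \<times> {0..1}"
    using ms(1) by (fastforce simp: ns_def Omega_def)
  moreover have "interior_moment \<alpha> \<beta> t q = (\<Sum>(w, z)\<leftarrow>ns. w * reflect_avg (monomial q) z)"
    if q: "q \<in> I" for q
  proof (cases "even (fst q) \<and> even (snd q)")
    case True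
    then have "(\<Sum>(w, z)\<leftarrow>ns. w * monomial q z) = (\<Sum>(w, z)\<leftarrow>ms. w * monomial q z)"
      unfolding ns_def by (induction ms) (auto simp: monomial_def power_even_abs)
    with True show ?thesis using ms(2)[OF q] by (simp add: reflect_avg_monomial)
  next
    case False
    then have "interior_moment \<alpha> \<beta> t q = 0"
      by (auto simp: interior_moment_def boundary_def power_avg_odd)
    moreover have "(\<Sum>(w, z)\<leftarrow>ns. w * reflect_avg (monomial q) z) = 0"
      using False by (induction ns) (auto simp: reflect_avg_monomial)
    ultimately show ?thesis by simp
  qed
  ultimately show ?thesis by blast
qed

lemma symmetric_cad_of_in_cone:
  assumes I: "finite I" and t: "t > 0" and pos: "\<alpha> > 0" "\<beta> > 0"
    and cone: "in_cone Omega monomial I (interior_moment \<alpha> \<beta> t)"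
  shows "\<exists>C. symmetric_cad (polys I) (t * \<alpha>) (t * \<beta>) C"
proof -
  obtain ns where ns: "\<forall>(w, z) \<in> set ns. w > 0 \<and> z \<in> {0..1} \<times> {0..1}"
    "\<And>q. q \<in> I \<Longrightarrow> interior_moment \<alpha> \<beta> t q = (\<Sum>(w, z)\<leftarrow>ns. w * reflect_avg (monomial q) z)"
    using interior_moment_symmetric_nodes[OF cone] by blast
  define C where "C = \<lparr>wx_minus = t * \<alpha>, wx_plus = t * \<alpha>, wy_minus = t * \<beta>, wy_plus = t * \<beta>,
    nodes = reflect_nodes ns\<rparr>"
  have "\<forall>(w, z) \<in> set (reflect_nodes ns). w > 0 \<and> z \<in> Omega"
    using ns(1) by (fastforce simp: reflect_nodes_def Omega_def)
  then have feas: "feasible_cad (polys I) C"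
    unfolding feasible_cad_polys_iff[OF I] using t pos
    by (auto simp: C_def sum_reflect_nodes ns(2)[symmetric] interior_moment_def boundary_def
        algebra_simps)
  moreover have "cell_avg p = 2 * (t * \<alpha>) * pair_avg_x p + 2 * (t * \<beta>) * pair_avg_y p +
      (\<Sum>(w, z)\<leftarrow>ns. w * reflect_avg p z)" if "p \<in> polys I" for p
    using feas that
    by (auto simp: feasible_cad_def C_def sum_reflect_nodes pair_avg_x_def pair_avg_y_def algebra_simps)
  ultimately show ?thesis
    using t pos ns(1) sum_reflect_nodes[of _ ns]
    unfolding symmetric_cad_def by (intro exI[of _ C]) (auto simp: C_def intro!: exI[of _ ns])
qed

section \<open>Existence of a balanced symmetric optimum\<close>

theorem theorem3p12:
  fixes k :: nat and V :: "(real \<times> real \<Rightarrow> real) set" and a1 a2 dx dy :: real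
  assumes "k \<ge> 1"
    and "V = poly_P k \<or> V = poly_Q k"
    and "a1 > 0" and "a2 > 0" and "dx > 0" and "dy > 0"
  shows "\<exists>C w1 w2. symmetric_cad V w1 w2 C \<and> optimal_cad V a1 a2 dx dy C \<and>
           w1 * dx / a1 = w2 * dy / a2"
proof -
  obtain I where I: "V = polys I" "finite I" "(0, 0) \<in> I" "I \<subseteq> {..k} \<times> {..k}"
  proof (cases "V = poly_P k")
    case True
    then show ?thesis
      by (intro that[of "Sigma {..k} (\<lambda>i. {..k - i})"]) (auto simp: poly_P_eq)
  next
    case False
    then show ?thesis
      using assms(2) by (intro that[of "{..k} \<times> {..k}"]) (auto simp: poly_Q_eq)
  qed
  \<comment> \<open>With these directions, boundary weights \<open>t * \<alpha>\<close> and
    \<open>t * \<beta>\<close> make all four terms of the objective equal to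
    \<open>t\<close>.\<close>
  define \<alpha> \<beta> where "\<alpha> = a1 / dx" and "\<beta> = a2 / dy"
  have pos: "\<alpha> > 0" "\<beta> > 0" using assms by (simp_all add: \<alpha>_def \<beta>_def)
  obtain t where t: "t > 0" "in_cone Omega monomial I (interior_moment \<alpha> \<beta> t)"
    "\<And>s. s \<ge> 0 \<Longrightarrow> in_cone Omega monomial I (interior_moment \<alpha> \<beta> s) \<Longrightarrow> s \<le> t"
    using interior_moment_maximum[OF I(2,3) assms(1) I(4) pos] by blast
  obtain C where C: "symmetric_cad V (t * \<alpha>) (t * \<beta>) C"
    using symmetric_cad_of_in_cone[OF I(2) t(1) pos t(2)] I(1) by blast
  have balance: "t * \<alpha> * dx / a1 = t" "t * \<beta> * dy / a2 = t"
    using assms by (simp_all add: \<alpha>_def \<beta>_def)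
  have objC: "cad_objective a1 a2 dx dy C = t"
    using C balance by (simp add: symmetric_cad_def cad_objective_def)
  have "cad_objective a1 a2 dx dy D \<le> t" if D: "feasible_cad V D" for D
  proof -
    \<comment> \<open>Every term of the minimum is at least \<open>s\<close>, so the weights of
      \<open>D\<close> dominate the balanced ones for the parameter \<open>s\<close>; maximality of
      \<open>t\<close> then applies.\<close>
    define s where "s = cad_objective a1 a2 dx dy D"
    have "s \<le> wx_minus D * dx / a1" "s \<le> wx_plus D * dx / a1"
      "s \<le> wy_minus D * dy / a2" "s \<le> wy_plus D * dy / a2"
      unfolding s_def cad_objective_def by (auto intro: Min_le)
    then have "s * \<alpha> \<le> wx_minus D" "s * \<alpha> \<le> wx_plus D" "s * \<beta> \<le> wy_minus D" "s * \<beta> \<le> wy_plus D"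
      using assms by (simp_all add: \<alpha>_def \<beta>_def field_simps)
    then have "in_cone Omega monomial I (interior_moment \<alpha> \<beta> s)"
      using feasible_imp_in_cone[OF assms(1) I(4)] D I(1) by blast
    moreover have "s \<ge> 0"
      using D assms by (simp add: s_def cad_objective_def feasible_cad_def)
    ultimately show ?thesis using t(3) s_def by blast
  qed
  then have "optimal_cad V a1 a2 dx dy C"
    using C objC by (simp add: optimal_cad_def symmetric_cad_def)
  with C balance show ?thesis by metis
qed

end
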